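(* Let $C_{\mathsf{MSE}}>0$. There exist constants $\kappa>0$, $c_{\mathrm{low}}>0$ and $N_0$, depending only on $C_{\mathsf{MSE}}$, such that for all $d\ge1$, all $n\ge N_0$, every measurable $f\colon(\mathbb R^d)^n\to\mathbb R^d$ that is $(C_{\mathsf{MSE}},\frac dn)$-uniformly MSE-accurate for $\{\mathcal N(\mu,\mathbb I_d)\}_{\mu\in\mathbb R^d}$, and every $\eta\in(0,1)$ with $1\le\lfloor\eta n\rfloor\le\kappa\sqrt n$, we have \[\sup_{\mu\in\mathbb R^d}\mathsf{ES}_{\eta,2}(f;\mu)\ge c_{\mathrm{low}}\,\eta.\]
   Context: For datasets $x,x'\in(\mathbb R^d)^n$, $d_H(x,x')=\#\{i\in[n]: x_i\neq x_i'\}$. For $f\colon(\mathbb R^d)^n\to\mathbb R^d$ and $\eta\in(0,1)$, $S^f_\eta(X)=\sup_{X'\colon d_H(X,X')\le\lfloor\eta n\rfloor}\|f(X)-f(X')\|_2$, and for $q\in\{1,2\}$, $\mathsf{ES}_{\eta,q}(f;\mu)=\big(\mathbb E_{X\sim\mathcal N(\mu,\mathbb I_d)^{\otimes n}}[S^f_\eta(X)^q]\big)^{1/q}$. $f$ is $(C_{\mathsf{MSE}},\frac dn)$-uniformly MSE-accurate if $\sup_{\mu\in\mathbb R^d}\mathbb E_{X\sim\mathcal N(\mu,\mathbb I_d)^{\otimes n}}\|f(X)-\mu\|_2^2\le C_{\mathsf{MSE}}\frac dn$. *)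

theory Defs
  imports "HOL-Probability.Probability"
begin

text \<open>Vectors in R^d are functions nat => real (coordinates j < d, extensional);
  datasets in (R^d)^n are functions nat => (nat => real) (rows i < n).\<close>

definition vnorm :: "nat \<Rightarrow> (nat \<Rightarrow> real) \<Rightarrow> real" where
  "vnorm d v = sqrt (\<Sum>j<d. (v j)\<^sup>2)"

definition gauss :: "nat \<Rightarrow> (nat \<Rightarrow> real) \<Rightarrow> (nat \<Rightarrow> real) measure" where
  "gauss d mu = PiM {..<d} (\<lambda>j. density lborel (normal_density (mu j) 1))"

definition gauss_data :: "nat \<Rightarrow> nat \<Rightarrow> (nat \<Rightarrow> real) \<Rightarrow> (nat \<Rightarrow> nat \<Rightarrow> real) measure" where
  "gauss_data d n mu = PiM {..<n} (\<lambda>i. gauss d mu)"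

definition vec_space :: "nat \<Rightarrow> (nat \<Rightarrow> real) measure" where
  "vec_space d = PiM {..<d} (\<lambda>j. borel)"

definition data_space :: "nat \<Rightarrow> nat \<Rightarrow> (nat \<Rightarrow> nat \<Rightarrow> real) measure" where
  "data_space d n = PiM {..<n} (\<lambda>i. vec_space d)"

definition hamming :: "nat \<Rightarrow> (nat \<Rightarrow> nat \<Rightarrow> real) \<Rightarrow> (nat \<Rightarrow> nat \<Rightarrow> real) \<Rightarrow> nat" where
  "hamming n X X' = card {i\<in>{..<n}. X i \<noteq> X' i}"

definition sens :: "nat \<Rightarrow> nat \<Rightarrow> ((nat \<Rightarrow> nat \<Rightarrow> real) \<Rightarrow> (nat \<Rightarrow> real)) \<Rightarrow> real
    \<Rightarrow> (nat \<Rightarrow> nat \<Rightarrow> real) \<Rightarrow> ennreal" where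
  "sens d n f eta X =
     (SUP X'\<in>{X' \<in> space (data_space d n). hamming n X X' \<le> nat \<lfloor>eta * real n\<rfloor>}.
        ennreal (vnorm d (\<lambda>j. f X j - f X' j)))"

definition ES2 :: "nat \<Rightarrow> nat \<Rightarrow> ((nat \<Rightarrow> nat \<Rightarrow> real) \<Rightarrow> (nat \<Rightarrow> real)) \<Rightarrow> real
    \<Rightarrow> (nat \<Rightarrow> real) \<Rightarrow> ennreal" where
  "ES2 d n f eta mu =
     (let E = (\<integral>\<^sup>+ X. (sens d n f eta X)\<^sup>2 \<partial>gauss_data d n mu)
      in if E = \<top> then \<top> else ennreal (sqrt (enn2real E)))"

definition unif_mse_accurate ::
  "real \<Rightarrow> nat \<Rightarrow> nat \<Rightarrow> ((nat \<Rightarrow> nat \<Rightarrow> real) \<Rightarrow> (nat \<Rightarrow> real)) \<Rightarrow> bool" where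
  "unif_mse_accurate C d n f \<longleftrightarrow>
     (\<forall>mu. (\<integral>\<^sup>+ X. ennreal ((vnorm d (\<lambda>j. f X j - mu j))\<^sup>2) \<partial>gauss_data d n mu)
             \<le> ennreal (C * real d / real n))"

end

theory Submission
  imports Defs
begin

text \<open>Put \<open>m = \<lfloor>\<eta> n\<rfloor>\<close> and let \<open>B\<close> be a random set of at most \<open>m\<close> indices containing each index with probability
  \<open>1 / G \<approx> m / n\<close>. Shifting the rows in \<open>B\<close> by \<open>t e\<^sub>j\<close> is an admissible corruption, so it moves the \<open>j\<close>-th
  coordinate of \<open>f\<close> by at most the sensitivity. On the other hand, the mixture over \<open>B\<close> of the shifted
  laws agrees to first order with the law of mean \<open>mu + (t / G) e\<^sub>j\<close>: the \<open>L\<^sup>2\<close> distance of the two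
  likelihood ratios is \<open>O(t\<^sup>2 \<surd>n / G)\<close> as long as \<open>m \<le> \<surd>n\<close>. As \<open>f\<^sub>j - mu\<^sub>j\<close> has standard deviation
  \<open>O(1 / \<surd>n)\<close> on average over \<open>j\<close>, this costs \<open>O(t\<^sup>2 / G)\<close> per coordinate, which for small \<open>t\<close> is negligible
  against the increment \<open>t / G\<close> of the mean. Since the bias of \<open>f\<close> is bounded, for a suitable \<open>mu\<close> the
  expectation of \<open>f\<close> does follow these increments, summed over the coordinates.\<close>

section \<open>Shifts of Gaussian product measures\<close>

text \<open>A product measure is determined by its values on measurable rectangles, and there the
  integral of the product density factorizes. The hypotheses range over all indices, as the locale
  \<open>product_sigma_finite\<close> asks.\<close>

lemma PiM_density:
  assumes fin: "finite I"
    and M: "\<And>i. prob_space (M i)" and N: "\<And>i. prob_space (density (M i) (f i))"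
    and f: "\<And>i. f i \<in> borel_measurable (M i)"
  shows "PiM I (\<lambda>i. density (M i) (f i)) = density (PiM I M) (\<lambda>x. \<Prod>i\<in>I. f i (x i))"
proof -
  interpret M: product_sigma_finite M
    using M by (simp add: product_sigma_finite_def prob_space_imp_sigma_finite)
  interpret N: product_sigma_finite "\<lambda>i. density (M i) (f i)"
    using N by (simp add: product_sigma_finite_def prob_space_imp_sigma_finite)
  note f[measurable]
  have meas: "(\<lambda>x. \<Prod>i\<in>I. f i (x i)) \<in> borel_measurable (PiM I M)"
    by measurable
  show ?thesis
  proof (rule N.PiM_eqI[OF fin, symmetric])
    show "sets (density (PiM I M) (\<lambda>x. \<Prod>i\<in>I. f i (x i))) = sets (PiM I (\<lambda>i. density (M i) (f i)))"
      by (simp cong: sets_PiM_cong)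
  next
    fix A assume "\<And>i. i \<in> I \<Longrightarrow> A i \<in> sets (density (M i) (f i))"
    then have A: "\<And>i. i \<in> I \<Longrightarrow> A i \<in> sets (M i)" by simp
    have "emeasure (density (PiM I M) (\<lambda>x. \<Prod>i\<in>I. f i (x i))) (Pi\<^sub>E I A)
        = (\<integral>\<^sup>+x. (\<Prod>i\<in>I. f i (x i)) * indicator (Pi\<^sub>E I A) x \<partial>PiM I M)"
      using fin A by (intro emeasure_density meas sets_PiM_I_finite) auto
    also have "\<dots> = (\<integral>\<^sup>+x. (\<Prod>i\<in>I. f i (x i) * indicator (A i) (x i)) \<partial>PiM I M)"
    proof (rule nn_integral_cong)
      fix x assume x: "x \<in> space (PiM I M)"
      have "indicator (Pi\<^sub>E I A) x = (\<Prod>i\<in>I. indicator (A i) (x i) :: ennreal)"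
      proof (cases "x \<in> Pi\<^sub>E I A")
        case True
        then show ?thesis by (auto simp: PiE_iff)
      next
        case False
        then obtain i where "i \<in> I" "x i \<notin> A i"
          using x by (auto simp: PiE_iff space_PiM)
        then have "(\<Prod>i\<in>I. indicator (A i) (x i) :: ennreal) = 0"
          using fin by (intro prod_zero) (auto simp: indicator_def)
        then show ?thesis using False by simp
      qed
      then show "(\<Prod>i\<in>I. f i (x i)) * indicator (Pi\<^sub>E I A) x
          = (\<Prod>i\<in>I. f i (x i) * indicator (A i) (x i))"
        by (simp add: prod.distrib)
    qed
    also have "\<dots> = (\<Prod>i\<in>I. \<integral>\<^sup>+x. f i x * indicator (A i) x \<partial>M i)"
      using A by (intro M.product_nn_integral_prod fin) auto
    also have "\<dots> = (\<Prod>i\<in>I. emeasure (density (M i) (f i)) (A i))"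
      using A by (intro prod.cong refl emeasure_density[symmetric]) auto
    finally show "emeasure (density (PiM I M) (\<lambda>x. \<Prod>i\<in>I. f i (x i))) (Pi\<^sub>E I A)
        = (\<Prod>i\<in>I. emeasure (density (M i) (f i)) (A i))" .
  qed
qed

text \<open>Both measures are compared on rectangles, whose preimages under a componentwise map are
  again rectangles.\<close>

lemma distr_PiM_componentwise:
  assumes fin: "finite I"
    and M: "\<And>i. prob_space (M i)"
    and f: "\<And>i. f i \<in> measurable (M i) (N i)"
  shows "distr (PiM I M) (PiM I N) (\<lambda>x. \<lambda>i\<in>I. f i (x i)) = PiM I (\<lambda>i. distr (M i) (N i) (f i))"
proof -
  interpret M: product_sigma_finite M
    using M by (simp add: product_sigma_finite_def prob_space_imp_sigma_finite)
  interpret N: product_sigma_finite "\<lambda>i. distr (M i) (N i) (f i)"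
    using M f
    by (simp add: product_sigma_finite_def prob_space_imp_sigma_finite prob_space.prob_space_distr)
  note f[measurable]
  have meas: "(\<lambda>x. \<lambda>i\<in>I. f i (x i)) \<in> measurable (PiM I M) (PiM I N)"
    by measurable
  show ?thesis
  proof (rule N.PiM_eqI[OF fin])
    show "sets (distr (PiM I M) (PiM I N) (\<lambda>x. \<lambda>i\<in>I. f i (x i)))
        = sets (PiM I (\<lambda>i. distr (M i) (N i) (f i)))"
      by (simp cong: sets_PiM_cong)
  next
    fix A assume "\<And>i. i \<in> I \<Longrightarrow> A i \<in> sets (distr (M i) (N i) (f i))"
    then have A: "\<And>i. i \<in> I \<Longrightarrow> A i \<in> sets (N i)" by simp
    have "emeasure (distr (PiM I M) (PiM I N) (\<lambda>x. \<lambda>i\<in>I. f i (x i))) (Pi\<^sub>E I A)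
        = emeasure (PiM I M) ((\<lambda>x. \<lambda>i\<in>I. f i (x i)) -` Pi\<^sub>E I A \<inter> space (PiM I M))"
      using fin A by (intro emeasure_distr meas sets_PiM_I_finite) auto
    also have "(\<lambda>x. \<lambda>i\<in>I. f i (x i)) -` Pi\<^sub>E I A \<inter> space (PiM I M)
        = (\<Pi>\<^sub>E i\<in>I. f i -` A i \<inter> space (M i))"
      by (auto simp: space_PiM PiE_iff)
    also have "emeasure (PiM I M) \<dots> = (\<Prod>i\<in>I. emeasure (M i) (f i -` A i \<inter> space (M i)))"
      using A fin by (intro M.emeasure_PiM) auto
    also have "\<dots> = (\<Prod>i\<in>I. emeasure (distr (M i) (N i) (f i)) (A i))"
      using A by (intro prod.cong refl emeasure_distr[symmetric]) auto
    finally show "emeasure (distr (PiM I M) (PiM I N) (\<lambda>x. \<lambda>i\<in>I. f i (x i))) (Pi\<^sub>E I A)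
        = (\<Prod>i\<in>I. emeasure (distr (M i) (N i) (f i)) (A i))" .
  qed
qed

section \<open>Tilting and shifting a single Gaussian\<close>

lemma density_normal_tilt:
  "density (density lborel (normal_density m 1)) (\<lambda>x. ennreal (exp (u * (x - m) - u\<^sup>2 / 2)))
    = density lborel (normal_density (m + u) 1)"
proof -
  have "normal_density m 1 x * exp (u * (x - m) - u\<^sup>2 / 2) = normal_density (m + u) 1 x" for x
    by (simp add: normal_density_def exp_add[symmetric] power2_eq_square field_simps)
  then show ?thesis
    by (simp add: density_density_eq ennreal_mult'[symmetric])
qed

lemma distr_normal_shift:
  assumes "sets N = sets borel"
  shows "distr (density lborel (normal_density m 1)) N (\<lambda>x. x + u)
    = density lborel (normal_density (m + u) 1)"
proof -
  have eq: "normal_density m 1 x = normal_density (m + u) 1 (u + x)" for x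
    by (simp add: normal_density_def)
  have "distr (density lborel (normal_density m 1)) N (\<lambda>x. x + u)
      = distr (density lborel (\<lambda>x. ennreal (normal_density (m + u) 1 (u + x)))) borel ((+) u)"
    using assms by (intro distr_cong) (auto simp: eq add.commute)
  also have "\<dots> = density (distr lborel borel ((+) u)) (normal_density (m + u) 1)"
    by (rule density_distr[symmetric]) auto
  finally show ?thesis by (simp add: lborel_distr_plus)
qed

text \<open>Likelihood ratio of the mean \<open>mu + v\<close> against the mean \<open>mu\<close>, for one row and (\<open>tilt\<close>) for a
  dataset whose \<open>i\<close>-th row is shifted by \<open>u i\<close>.\<close>

definition vtilt :: "nat \<Rightarrow> (nat \<Rightarrow> real) \<Rightarrow> (nat \<Rightarrow> real) \<Rightarrow> (nat \<Rightarrow> real) \<Rightarrow> real" where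
  "vtilt d mu v x = exp (\<Sum>j<d. v j * (x j - mu j) - (v j)\<^sup>2 / 2)"

definition tilt :: "nat \<Rightarrow> nat \<Rightarrow> (nat \<Rightarrow> real) \<Rightarrow> (nat \<Rightarrow> nat \<Rightarrow> real) \<Rightarrow> (nat \<Rightarrow> nat \<Rightarrow> real) \<Rightarrow> real"
  where "tilt d n mu u X = exp (\<Sum>i<n. \<Sum>j<d. u i j * (X i j - mu j) - (u i j)\<^sup>2 / 2)"

text \<open>The restrictions make the result extensional, so that it is a point of
  \<open>data_space d n\<close>.\<close>

definition shift :: "nat \<Rightarrow> nat \<Rightarrow> (nat \<Rightarrow> nat \<Rightarrow> real) \<Rightarrow> (nat \<Rightarrow> nat \<Rightarrow> real) \<Rightarrow> nat \<Rightarrow> nat \<Rightarrow> real"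
  where "shift d n u X = (\<lambda>i\<in>{..<n}. \<lambda>j\<in>{..<d}. X i j + u i j)"

lemma tilt_nonneg: "0 \<le> tilt d n mu u X"
  by (simp add: tilt_def)

lemma sets_gauss: "sets (gauss d mu) = sets (vec_space d)"
  unfolding gauss_def vec_space_def by (rule sets_PiM_cong) auto

lemma sets_gauss_data: "sets (gauss_data d n mu) = sets (data_space d n)"
  unfolding gauss_data_def data_space_def by (rule sets_PiM_cong) (auto simp: sets_gauss)

lemma prob_space_gauss: "prob_space (gauss d mu)"
  unfolding gauss_def by (intro prob_space_PiM prob_space_normal_density) simp

lemma prob_space_gauss_data: "prob_space (gauss_data d n mu)"
  unfolding gauss_data_def by (intro prob_space_PiM prob_space_gauss)

lemma gauss_tilt:
  "density (gauss d mu) (\<lambda>x. ennreal (vtilt d mu v x)) = gauss d (\<lambda>j. mu j + v j)"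
proof -
  have "gauss d (\<lambda>j. mu j + v j) = PiM {..<d} (\<lambda>j. density (density lborel (normal_density (mu j) 1))
      (\<lambda>x. ennreal (exp (v j * (x - mu j) - (v j)\<^sup>2 / 2))))"
    unfolding gauss_def density_normal_tilt ..
  also have "\<dots> = density (gauss d mu) (\<lambda>x. \<Prod>j<d. ennreal (exp (v j * (x j - mu j) - (v j)\<^sup>2 / 2)))"
    unfolding gauss_def
    by (rule PiM_density) (auto simp: density_normal_tilt intro!: prob_space_normal_density)
  finally show ?thesis by (simp add: vtilt_def exp_sum prod_ennreal)
qed

lemma gauss_shift:
  assumes "sets N = sets (vec_space d)"
  shows "distr (gauss d mu) N (\<lambda>x. \<lambda>j\<in>{..<d}. x j + v j) = gauss d (\<lambda>j. mu j + v j)"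
proof -
  have "gauss d (\<lambda>j. mu j + v j) =
      PiM {..<d} (\<lambda>j. distr (density lborel (normal_density (mu j) 1)) borel (\<lambda>x. x + v j))"
    unfolding gauss_def by (simp add: distr_normal_shift)
  also have "\<dots> = distr (gauss d mu) (vec_space d) (\<lambda>x. \<lambda>j\<in>{..<d}. x j + v j)"
    unfolding gauss_def vec_space_def
    by (rule distr_PiM_componentwise[symmetric]) (auto intro!: prob_space_normal_density)
  also have "\<dots> = distr (gauss d mu) N (\<lambda>x. \<lambda>j\<in>{..<d}. x j + v j)"
    using assms by (intro distr_cong) auto
  finally show ?thesis ..
qed

lemma measurable_vtilt[measurable]: "vtilt d mu v \<in> borel_measurable (gauss d mu')"
  unfolding measurable_cong_sets[OF sets_gauss refl] vec_space_def vtilt_def[abs_def] by measurable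

lemma measurable_entry:
  "i < n \<Longrightarrow> j < d \<Longrightarrow> (\<lambda>X. X i j) \<in> borel_measurable (data_space d n)"
  unfolding data_space_def vec_space_def
  by (rule measurable_compose[of _ _ "PiM {..<d} (\<lambda>j. borel)"]) (auto intro!: measurable_component_singleton)

lemma measurable_shift[measurable]: "shift d n u \<in> measurable (data_space d n) (data_space d n)"
proof -
  have "shift d n u \<in> measurable (data_space d n) (PiM {..<n} (\<lambda>i. PiM {..<d} (\<lambda>j. borel)))"
    unfolding shift_def[abs_def]
    by (intro measurable_restrict borel_measurable_add measurable_entry borel_measurable_const) auto
  then show ?thesis by (simp add: data_space_def vec_space_def)
qed

lemma measurable_tilt[measurable]: "tilt d n mu u \<in> borel_measurable (data_space d n)"
  unfolding tilt_def[abs_def]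
  by (intro borel_measurable_sum borel_measurable_diff borel_measurable_times
      measurable_entry borel_measurable_const measurable_compose[OF _ borel_measurable_exp]) auto

section \<open>Change of measure for whole datasets\<close>

lemma PiM_gauss_tilt:
  "density (gauss_data d n mu) (\<lambda>X. ennreal (tilt d n mu u X))
    = PiM {..<n} (\<lambda>i. gauss d (\<lambda>j. mu j + u i j))"
proof -
  have "PiM {..<n} (\<lambda>i. gauss d (\<lambda>j. mu j + u i j))
      = PiM {..<n} (\<lambda>i. density (gauss d mu) (\<lambda>x. ennreal (vtilt d mu (u i) x)))"
    by (simp add: gauss_tilt)
  also have "\<dots> = density (gauss_data d n mu) (\<lambda>X. \<Prod>i<n. ennreal (vtilt d mu (u i) (X i)))"
    unfolding gauss_data_def
    by (rule PiM_density) (auto simp: gauss_tilt intro!: prob_space_gauss)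
  finally show ?thesis by (simp add: vtilt_def tilt_def exp_sum prod_ennreal prod_nonneg)
qed

lemma PiM_gauss_shift:
  "distr (gauss_data d n mu) (data_space d n) (shift d n u)
    = PiM {..<n} (\<lambda>i. gauss d (\<lambda>j. mu j + u i j))"
proof -
  have "PiM {..<n} (\<lambda>i. gauss d (\<lambda>j. mu j + u i j))
      = PiM {..<n} (\<lambda>i. distr (gauss d mu) (vec_space d) (\<lambda>x. \<lambda>j\<in>{..<d}. x j + u i j))"
    by (simp add: gauss_shift)
  also have "\<dots> = distr (gauss_data d n mu) (data_space d n) (\<lambda>X. \<lambda>i\<in>{..<n}. \<lambda>j\<in>{..<d}. X i j + u i j)"
    unfolding gauss_data_def data_space_def
  proof (rule distr_PiM_componentwise[symmetric])
    show "(\<lambda>x. \<lambda>j\<in>{..<d}. x j + u i j) \<in> gauss d mu \<rightarrow>\<^sub>M vec_space d" for i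
      unfolding measurable_cong_sets[OF sets_gauss refl] vec_space_def by measurable
  qed (auto intro!: prob_space_gauss)
  finally show ?thesis by (simp add: shift_def[abs_def])
qed

lemma integrable_tilt: "integrable (gauss_data d n mu) (tilt d n mu u)"
  and integral_tilt: "(\<integral>X. tilt d n mu u X \<partial>gauss_data d n mu) = 1"
proof -
  interpret P: prob_space "density (gauss_data d n mu) (\<lambda>X. ennreal (tilt d n mu u X))"
    unfolding PiM_gauss_tilt by (intro prob_space_PiM prob_space_gauss)
  have m: "tilt d n mu u \<in> borel_measurable (gauss_data d n mu)"
    unfolding measurable_cong_sets[OF sets_gauss_data refl] by measurable
  have "(\<integral>\<^sup>+X. ennreal (tilt d n mu u X) \<partial>gauss_data d n mu) = 1"
    using P.emeasure_space_1 m by (simp add: emeasure_density)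
  then have "has_bochner_integral (gauss_data d n mu) (tilt d n mu u) 1"
    using m by (intro has_bochner_integral_nn_integral) (auto simp: tilt_nonneg)
  then show "integrable (gauss_data d n mu) (tilt d n mu u)"
    "(\<integral>X. tilt d n mu u X \<partial>gauss_data d n mu) = 1"
    by (auto simp: has_bochner_integral_iff)
qed

text \<open>The image measure under \<open>shift\<close> and the measure with density
  \<open>tilt\<close> are the same product of Gaussians with row means \<open>mu + u i\<close>. This
  turns a corruption of the data into a change of measure.\<close>

lemma integral_shift:
  assumes [measurable]: "(h :: _ \<Rightarrow> real) \<in> borel_measurable (data_space d n)"
  shows "(\<integral>X. h (shift d n u X) \<partial>gauss_data d n mu) = (\<integral>X. tilt d n mu u X * h X \<partial>gauss_data d n mu)"
    and "integrable (gauss_data d n mu) (\<lambda>X. h (shift d n u X)) \<longleftrightarrow>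
      integrable (gauss_data d n mu) (\<lambda>X. tilt d n mu u X * h X)"
proof -
  note measurable_cong_sets[OF sets_gauss_data refl, simp]
  have eq: "distr (gauss_data d n mu) (data_space d n) (shift d n u)
      = density (gauss_data d n mu) (\<lambda>X. ennreal (tilt d n mu u X))"
    by (simp add: PiM_gauss_shift PiM_gauss_tilt)
  have "(\<integral>X. h (shift d n u X) \<partial>gauss_data d n mu)
      = integral\<^sup>L (distr (gauss_data d n mu) (data_space d n) (shift d n u)) h"
    by (rule integral_distr[symmetric]) auto
  then show "(\<integral>X. h (shift d n u X) \<partial>gauss_data d n mu)
      = (\<integral>X. tilt d n mu u X * h X \<partial>gauss_data d n mu)"
    unfolding eq by (simp add: integral_density tilt_nonneg)
  have "integrable (gauss_data d n mu) (\<lambda>X. h (shift d n u X)) \<longleftrightarrow>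
      integrable (distr (gauss_data d n mu) (data_space d n) (shift d n u)) h"
    by (rule integrable_distr_eq[symmetric]) auto
  then show "integrable (gauss_data d n mu) (\<lambda>X. h (shift d n u X)) \<longleftrightarrow>
      integrable (gauss_data d n mu) (\<lambda>X. tilt d n mu u X * h X)"
    unfolding eq by (simp add: integrable_density tilt_nonneg)
qed

lemma integral_gauss_data_add:
  assumes [measurable]: "(h :: _ \<Rightarrow> real) \<in> borel_measurable (data_space d n)"
  shows "(\<integral>X. h X \<partial>gauss_data d n (\<lambda>j. mu j + v j))
    = (\<integral>X. tilt d n mu (\<lambda>i. v) X * h X \<partial>gauss_data d n mu)"
proof -
  have "gauss_data d n (\<lambda>j. mu j + v j)
      = density (gauss_data d n mu) (\<lambda>X. ennreal (tilt d n mu (\<lambda>i. v) X))"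
    unfolding PiM_gauss_tilt by (simp add: gauss_data_def)
  then show ?thesis
    by (simp add: integral_density measurable_cong_sets[OF sets_gauss_data refl] tilt_nonneg)
qed

text \<open>Completing the square: \<open>- u^2 / 2 - w^2 / 2 = u w - (u + w)^2 / 2\<close>. As
  every \<open>tilt\<close> has integral 1, this makes the \<open>L^2\<close> inner products of
  likelihood ratios explicit.\<close>

lemma tilt_mult:
  "tilt d n mu u X * tilt d n mu w X
    = exp (\<Sum>i<n. \<Sum>j<d. u i j * w i j) * tilt d n mu (\<lambda>i j. u i j + w i j) X"
  unfolding tilt_def exp_add[symmetric] sum.distrib[symmetric]
  by (intro arg_cong[where f = exp] sum.cong refl) (simp add: power2_eq_square field_simps)

lemma integrable_tilt_mult: "integrable (gauss_data d n mu) (\<lambda>X. tilt d n mu u X * tilt d n mu w X)"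
  and integral_tilt_mult: "(\<integral>X. tilt d n mu u X * tilt d n mu w X \<partial>gauss_data d n mu)
    = exp (\<Sum>i<n. \<Sum>j<d. u i j * w i j)"
  by (simp_all add: tilt_mult integrable_tilt integral_tilt)

section \<open>Random transversals\<close>

abbreviation picks :: "nat \<Rightarrow> nat \<Rightarrow> (nat \<Rightarrow> nat) set" where
  "picks m G \<equiv> PiE {..<m} (\<lambda>_. {..<G})"

text \<open>The indices \<open>i < n\<close> are cut into \<open>m\<close> consecutive blocks of length \<open>G\<close>, and \<open>b\<close> picks one position
  in each block. Positions beyond \<open>n\<close> are padding: thanks to them, every index is selected with
  probability exactly \<open>1 / G\<close> even when \<open>G\<close> does not divide \<open>n\<close>.\<close>

definition sel :: "nat \<Rightarrow> (nat \<Rightarrow> nat) \<Rightarrow> nat \<Rightarrow> bool" where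
  "sel G b i \<longleftrightarrow> b (i div G) = i mod G"

lemma sum_grid:
  fixes f :: "nat \<Rightarrow> real"
  assumes "n \<le> m * G"
  shows "(\<Sum>i<n. f i) = (\<Sum>k<m. \<Sum>c<G. of_bool (k * G + c < n) * f (k * G + c))"
proof -
  have "(\<Sum>i<n. f i) = (\<Sum>i<m * G. of_bool (i < n) * f i)"
    using assms by (intro sum.mono_neutral_cong_left) auto
  also have "\<dots> = (\<Sum>k<m. \<Sum>i\<in>{k * G..<k * G + G}. of_bool (i < n) * f i)"
    by (rule sum.nat_group[symmetric])
  also have "\<dots> = (\<Sum>k<m. \<Sum>c<G. of_bool (k * G + c < n) * f (k * G + c))"
  proof (rule sum.cong[OF refl])
    fix k
    show "(\<Sum>i\<in>{k * G..<k * G + G}. of_bool (i < n) * f i)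
        = (\<Sum>c<G. of_bool (k * G + c < n) * f (k * G + c))"
      using sum.shift_bounds_nat_ivl[of "\<lambda>i. of_bool (i < n) * f i" 0 "k * G" G]
      by (simp add: atLeast0LessThan add.commute)
  qed
  finally show ?thesis .
qed

text \<open>Block \<open>k\<close> has the single selected position \<open>k * G + b k\<close>,
  which counts only if it is not padding.\<close>

lemma sum_sel:
  fixes f :: "nat \<Rightarrow> real"
  assumes "n \<le> m * G" "b \<in> picks m G"
  shows "(\<Sum>i<n. of_bool (sel G b i) * f i) = (\<Sum>k<m. of_bool (k * G + b k < n) * f (k * G + b k))"
  unfolding sum_grid[OF assms(1)]
proof (rule sum.cong[OF refl])
  fix k assume "k \<in> {..<m}"
  then have bk: "b k < G" using assms(2) by auto
  have "(\<Sum>c<G. of_bool (k * G + c < n) * (of_bool (sel G b (k * G + c)) * f (k * G + c)))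
      = (\<Sum>c<G. if c = b k then of_bool (k * G + b k < n) * f (k * G + b k) else 0)"
    by (rule sum.cong) (auto simp: sel_def)
  also have "\<dots> = of_bool (k * G + b k < n) * f (k * G + b k)"
    using bk by simp
  finally show "(\<Sum>c<G. of_bool (k * G + c < n) * (of_bool (sel G b (k * G + c)) * f (k * G + c)))
      = of_bool (k * G + b k < n) * f (k * G + b k)" .
qed

section \<open>Exponential moments of the random transversal\<close>

lemma prod_one_plus_ge:
  fixes x :: "'a \<Rightarrow> real"
  assumes "finite A" "\<And>k. k \<in> A \<Longrightarrow> 0 \<le> x k"
  shows "1 + (\<Sum>k\<in>A. x k) \<le> (\<Prod>k\<in>A. 1 + x k)"
  using assms
proof (induction A)
  case (insert a A)
  have "0 \<le> x a * (\<Sum>k\<in>A. x k)" using insert by (auto intro!: mult_nonneg_nonneg sum_nonneg)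
  then have "1 + (x a + (\<Sum>k\<in>A. x k)) \<le> (1 + x a) * (1 + (\<Sum>k\<in>A. x k))"
    by (simp add: algebra_simps)
  also have "\<dots> \<le> (1 + x a) * (\<Prod>k\<in>A. 1 + x k)"
    using insert by (intro mult_left_mono) auto
  finally show ?case using insert by simp
qed simp

text \<open>Divided by \<open>G ^ m\<close>, the right-hand side is the moment generating function
  of the number of selected indices, whose mean is \<open>n / G\<close>. It factorizes over the
  blocks, and \<open>1 + x \<le> exp x\<close> is applied in each. A first-order lower bound is
  enough, since in the \<open>L^2\<close> distance this term is subtracted.\<close>

lemma sum_picks_exp_ge:
  fixes \<tau> :: real
  assumes n: "n \<le> m * G" and G: "0 < G" and \<tau>: "0 \<le> \<tau>"
  shows "real G ^ m * (1 + \<tau> * n / G)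
    \<le> (\<Sum>b\<in>picks m G. exp (\<tau> * (\<Sum>i<n. of_bool (sel G b i))))"
proof -
  \<comment> \<open>The number of non-padding positions in block \<open>k\<close>; these numbers add
    up to \<open>n\<close>.\<close>
  define g where "g k = (\<Sum>c<G. of_bool (k * G + c < n) :: real)" for k
  have g0: "0 \<le> g k" for k by (simp add: g_def sum_nonneg)
  have sg: "(\<Sum>k<m. g k) = n"
    using sum_grid[OF n, of "\<lambda>_. 1"] by (simp add: g_def)
  have "real G ^ m * (1 + \<tau> * n / G) = real G ^ m * (1 + (\<Sum>k<m. \<tau> * g k / G))"
    by (simp add: sg[symmetric] sum_distrib_left sum_divide_distrib)
  also have "\<dots> \<le> real G ^ m * (\<Prod>k<m. 1 + \<tau> * g k / G)"
    using \<tau> g0 by (intro mult_left_mono prod_one_plus_ge) auto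
  also have "\<dots> = (\<Prod>k<m. G * (1 + \<tau> * g k / G))"
    by (simp add: prod.distrib)
  also have "\<dots> \<le> (\<Prod>k<m. \<Sum>c<G. exp (\<tau> * of_bool (k * G + c < n)))"
  proof (intro prod_mono conjI)
    fix k
    show "0 \<le> real G * (1 + \<tau> * g k / real G)" using \<tau> g0[of k] by simp
    have "real G * (1 + \<tau> * g k / real G) = (\<Sum>c<G. 1 + \<tau> * of_bool (k * G + c < n))"
      using G by (simp add: g_def sum.distrib sum_distrib_left field_simps)
    also have "\<dots> \<le> (\<Sum>c<G. exp (\<tau> * of_bool (k * G + c < n)))"
      by (intro sum_mono exp_ge_add_one_self)
    finally show "real G * (1 + \<tau> * g k / real G) \<le> (\<Sum>c<G. exp (\<tau> * of_bool (k * G + c < n)))" .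
  qed
  also have "\<dots> = (\<Sum>b\<in>picks m G. \<Prod>k<m. exp (\<tau> * of_bool (k * G + b k < n)))"
    by (rule prod_sum_PiE) auto
  also have "\<dots> = (\<Sum>b\<in>picks m G. exp (\<tau> * (\<Sum>i<n. of_bool (sel G b i))))"
  proof (rule sum.cong[OF refl])
    fix b assume b: "b \<in> picks m G"
    show "(\<Prod>k<m. exp (\<tau> * of_bool (k * G + b k < n))) = exp (\<tau> * (\<Sum>i<n. of_bool (sel G b i)))"
    proof -
      have eq: "(\<Sum>i<n. of_bool (sel G b i) :: real) = (\<Sum>k<m. of_bool (k * G + b k < n))"
        using sum_sel[OF n b, of "\<lambda>_. 1"] by (simp only: mult_1_right)
      show ?thesis
        unfolding eq sum_distrib_left by (rule exp_sum[symmetric]) simp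
    qed
  qed
  finally show ?thesis .
qed

text \<open>For fixed \<open>b\<close>, the picks of \<open>b\<close> and \<open>b'\<close> in a
  block agree with probability \<open>1 / G\<close>, independently over the blocks. So the sum over
  \<open>b'\<close> is a product, and the sum over \<open>b\<close> factorizes once more. In the
  exponent, \<open>n / G^2\<close> is the mean size of the overlap.\<close>

lemma sum_picks_overlap_le:
  fixes s :: real
  assumes n: "n \<le> m * G" and G: "0 < G" and s: "0 \<le> s"
  shows "(\<Sum>b\<in>picks m G. \<Sum>b'\<in>picks m G.
      exp (s * (\<Sum>i<n. of_bool (sel G b i) * of_bool (sel G b' i))))
    \<le> (real G ^ m)\<^sup>2 * exp ((exp s - 1) * n / (real G)\<^sup>2)"
proof -
  define g where "g k = (\<Sum>c<G. of_bool (k * G + c < n) :: real)" for k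
  have g0: "0 \<le> g k" for k by (simp add: g_def sum_nonneg)
  have sg: "(\<Sum>k<m. g k) = n"
    using sum_grid[OF n, of "\<lambda>_. 1"] by (simp add: g_def)
  have inner: "(\<Sum>b'\<in>picks m G. exp (s * (\<Sum>i<n. of_bool (sel G b i) * of_bool (sel G b' i))))
      = (\<Prod>k<m. G + (exp s - 1) * of_bool (k * G + b k < n))" if b: "b \<in> picks m G" for b
  proof -
    have "exp (s * (\<Sum>i<n. of_bool (sel G b i) * of_bool (sel G b' i)))
        = (\<Prod>k<m. exp (s * of_bool (k * G + b k < n \<and> b' k = b k)))" if "b' \<in> picks m G" for b'
    proof -
      have "(\<Sum>i<n. of_bool (sel G b i) * of_bool (sel G b' i) :: real)
          = (\<Sum>k<m. of_bool (k * G + b k < n) * of_bool (sel G b' (k * G + b k)))"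
        by (rule sum_sel[OF n b])
      also have "\<dots> = (\<Sum>k<m. of_bool (k * G + b k < n \<and> b' k = b k))"
      proof (rule sum.cong[OF refl])
        fix k assume "k \<in> {..<m}"
        then have "b k < G" using b by auto
        then have "(k * G + b k) div G = k" "(k * G + b k) mod G = b k" by auto
        then show "of_bool (k * G + b k < n) * of_bool (sel G b' (k * G + b k))
            = (of_bool (k * G + b k < n \<and> b' k = b k) :: real)"
          by (auto simp: sel_def)
      qed
      finally have eq: "(\<Sum>i<n. of_bool (sel G b i) * of_bool (sel G b' i) :: real)
          = (\<Sum>k<m. of_bool (k * G + b k < n \<and> b' k = b k))" .
      show ?thesis
        unfolding eq sum_distrib_left by (rule exp_sum) simp
    qed
    then have "(\<Sum>b'\<in>picks m G. exp (s * (\<Sum>i<n. of_bool (sel G b i) * of_bool (sel G b' i))))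
        = (\<Sum>b'\<in>picks m G. \<Prod>k<m. exp (s * of_bool (k * G + b k < n \<and> b' k = b k)))"
      by (intro sum.cong refl)
    also have "\<dots> = (\<Prod>k<m. \<Sum>c<G. exp (s * of_bool (k * G + b k < n \<and> c = b k)))"
      by (rule prod_sum_PiE[symmetric]) auto
    also have "\<dots> = (\<Prod>k<m. G + (exp s - 1) * of_bool (k * G + b k < n))"
    proof (rule prod.cong[OF refl])
      fix k assume "k \<in> {..<m}"
      then have bk: "b k < G" using b by auto
      have "(\<Sum>c<G. exp (s * of_bool (k * G + b k < n \<and> c = b k)))
          = (\<Sum>c<G. 1 + (if c = b k then (exp s - 1) * of_bool (k * G + b k < n) else 0))"
        by (rule sum.cong) auto
      also have "\<dots> = G + (exp s - 1) * of_bool (k * G + b k < n)"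
        using bk by (simp add: sum.distrib)
      finally show "(\<Sum>c<G. exp (s * of_bool (k * G + b k < n \<and> c = b k)))
          = G + (exp s - 1) * of_bool (k * G + b k < n)" .
    qed
    finally show ?thesis .
  qed
  have "(\<Sum>b\<in>picks m G. \<Sum>b'\<in>picks m G.
      exp (s * (\<Sum>i<n. of_bool (sel G b i) * of_bool (sel G b' i))))
    = (\<Sum>b\<in>picks m G. \<Prod>k<m. G + (exp s - 1) * of_bool (k * G + b k < n))"
    by (rule sum.cong[OF refl inner])
  also have "\<dots> = (\<Prod>k<m. \<Sum>c<G. G + (exp s - 1) * of_bool (k * G + c < n))"
    by (rule prod_sum_PiE[symmetric]) auto
  also have "\<dots> \<le> (\<Prod>k<m. (real G)\<^sup>2 * exp ((exp s - 1) * g k / (real G)\<^sup>2))"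
  proof (intro prod_mono conjI)
    fix k
    show "0 \<le> (\<Sum>c<G. G + (exp s - 1) * of_bool (k * G + c < n))"
      using s by (intro sum_nonneg add_nonneg_nonneg mult_nonneg_nonneg) auto
    have "(\<Sum>c<G. G + (exp s - 1) * of_bool (k * G + c < n)) = real G * real G + (exp s - 1) * g k"
      by (simp only: g_def sum.distrib sum_distrib_left sum_constant card_lessThan)
    also have "\<dots> = (real G)\<^sup>2 * (1 + (exp s - 1) * g k / (real G)\<^sup>2)"
      using G by (simp add: field_simps power2_eq_square)
    also have "\<dots> \<le> (real G)\<^sup>2 * exp ((exp s - 1) * g k / (real G)\<^sup>2)"
      by (intro mult_left_mono exp_ge_add_one_self) auto
    finally show "(\<Sum>c<G. G + (exp s - 1) * of_bool (k * G + c < n))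
        \<le> (real G)\<^sup>2 * exp ((exp s - 1) * g k / (real G)\<^sup>2)" .
  qed
  also have "\<dots> = (real G ^ m)\<^sup>2 * exp ((exp s - 1) * n / (real G)\<^sup>2)"
    by (simp add: prod.distrib exp_sum[symmetric] sg[symmetric] sum_distrib_left
        sum_divide_distrib power_mult[symmetric] mult.commute)
  finally show ?thesis .
qed

text \<open>A selected index is determined by its block, because \<open>sel\<close> prescribes its
  residue modulo \<open>G\<close>.\<close>

lemma card_sel_le:
  assumes "n \<le> m * G"
  shows "card {i\<in>{..<n}. sel G b i} \<le> m"
proof -
  have "inj_on (\<lambda>i. i div G) {i\<in>{..<n}. sel G b i}"
    by (rule inj_onI) (metis (mono_tags, lifting) div_mult_mod_eq mem_Collect_eq sel_def)
  moreover have "(\<lambda>i. i div G) ` {i\<in>{..<n}. sel G b i} \<subseteq> {..<m}"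
    using assms by (auto simp: less_mult_imp_div_less)
  ultimately show ?thesis using card_inj_on_le[of _ _ "{..<m}"] by fastforce
qed

text \<open>The constant and first-order terms cancel. What remains is \<open>s^2 a\<close> from
  \<open>exp s - 1\<close>, at most \<open>2 s^2 a\<close> from the square of
  \<open>(exp s - 1) a\<close>, and at most \<open>s^2 a\<close> from the square of
  \<open>s a\<close>.\<close>

lemma exp_second_order:
  fixes a s :: real
  assumes "0 \<le> a" "a \<le> 1" "0 \<le> s" "s \<le> 1 / 4"
  shows "exp ((exp s - 1) * a) - 2 * (1 + s * a) + exp (s * a) \<le> 4 * s\<^sup>2 * a"
proof -
  have es: "exp s - 1 \<le> s + s\<^sup>2" using exp_bound[of s] assms by simp
  have ss: "s\<^sup>2 \<le> s / 4" using mult_right_mono[of s "1 / 4" s] assms by (simp add: power2_eq_square)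
  define y where "y = (exp s - 1) * a"
  have aa: "a\<^sup>2 \<le> a" using assms by (simp add: power2_eq_square mult_left_le)
  have y0: "0 \<le> y" using assms by (simp add: y_def)
  have y1: "y \<le> (s + s\<^sup>2) * a" unfolding y_def using es assms by (intro mult_right_mono) auto
  have y2: "y \<le> 5 / 4 * (s * a)"
    using y1 mult_right_mono[OF ss assms(1)] by (simp add: algebra_simps)
  have sa: "s * a \<le> 1 / 4" using mult_mono[of s "1/4" a 1] assms by simp
  have sa0: "0 \<le> s * a" using assms by simp
  have sasq: "(s * a)\<^sup>2 \<le> s\<^sup>2 * a" using aa by (simp add: power_mult_distrib mult_left_mono)
  have "y\<^sup>2 \<le> (5 / 4 * (s * a))\<^sup>2" using y2 y0 by (rule power_mono)
  also have "\<dots> = 25 / 16 * (s * a)\<^sup>2" by (simp only: power_mult_distrib) (simp add: power2_eq_square)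
  also have "\<dots> \<le> 2 * (s\<^sup>2 * a)" using sasq assms zero_le_power2[of "s*a"] by linarith
  finally have ysq: "y\<^sup>2 \<le> 2 * (s\<^sup>2 * a)" .
  have "exp y \<le> 1 + y + y\<^sup>2" using exp_bound[of y] y0 y2 sa by simp
  moreover have "exp (s * a) \<le> 1 + s * a + (s * a)\<^sup>2" using exp_bound[of "s * a"] sa0 sa by simp
  ultimately show ?thesis
    using y1 ysq sasq unfolding y_def[symmetric] by (simp add: algebra_simps)
qed

section \<open>Discrete divergence\<close>

text \<open>On each of the \<open>N ^ (d - 1)\<close> grid lines in direction \<open>j\<close> the
  increments telescope to a difference of two end values, which is at least
  \<open>- 2 M\<close>.\<close>

lemma sum_grid_increment:
  fixes P :: "(nat \<Rightarrow> nat) \<Rightarrow> real"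
  assumes j: "j < d" and M: "\<And>k. \<bar>P k\<bar> \<le> M"
  shows "- (2 * M * real N ^ (d - 1)) \<le> (\<Sum>k\<in>picks d N. P (k(j := Suc (k j))) - P k)"
proof -
  define S where "S = {..<d} - {j}"
  have dS: "{..<d} = insert j S" and jS: "j \<notin> S" and fS: "finite S"
    using j by (auto simp: S_def)
  have cS: "card S = d - 1" using j by (simp add: S_def)
  have "(\<Sum>k\<in>picks d N. P (k(j := Suc (k j))) - P k)
      = (\<Sum>(y, h)\<in>{..<N} \<times> PiE S (\<lambda>_. {..<N}). P (h(j := Suc y)) - P (h(j := y)))"
    unfolding dS PiE_insert_eq
    by (subst sum.reindex[OF inj_combinator[OF jS]]) (simp add: case_prod_beta)
  also have "\<dots> = (\<Sum>y<N. \<Sum>h\<in>PiE S (\<lambda>_. {..<N}). P (h(j := Suc y)) - P (h(j := y)))"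
    by (simp add: sum.cartesian_product)
  also have "\<dots> = (\<Sum>h\<in>PiE S (\<lambda>_. {..<N}). \<Sum>y<N. P (h(j := Suc y)) - P (h(j := y)))"
    by (rule sum.swap)
  also have "\<dots> = (\<Sum>h\<in>PiE S (\<lambda>_. {..<N}). P (h(j := N)) - P (h(j := 0)))"
    by (intro sum.cong refl sum_lessThan_telescope)
  also have "\<dots> \<ge> (\<Sum>h\<in>PiE S (\<lambda>_. {..<N}). - (2 * M))"
  proof (rule sum_mono)
    fix h show "- (2 * M) \<le> P (h(j := N)) - P (h(j := 0))"
      using M[of "h(j := N)"] M[of "h(j := 0)"] by linarith
  qed
  finally show ?thesis using fS by (simp add: card_PiE cS mult.commute)
qed

text \<open>Averaged over a large cube, the increments telescope to boundary terms.\<close>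

lemma bounded_field_divergence:
  fixes \<psi> :: "nat \<Rightarrow> (nat \<Rightarrow> real) \<Rightarrow> real"
  assumes M: "\<And>j mu. j < d \<Longrightarrow> \<bar>\<psi> j mu\<bar> \<le> M" and \<epsilon>: "0 < \<epsilon>"
  shows "\<exists>mu. - \<epsilon> \<le> (\<Sum>j<d. \<psi> j (\<lambda>i. mu i + (if i = j then \<delta> else 0)) - \<psi> j mu)"
proof (rule ccontr)
  assume neg: "\<not> ?thesis"
  define pt where "pt k = (\<lambda>i. \<delta> * real (k i))" for k :: "nat \<Rightarrow> nat"
  \<comment> \<open>Summed over the \<open>N ^ d\<close> grid points, \<open>neg\<close> gives less
    than \<open>- \<epsilon> N^d\<close>, while the boundary terms of all directions amount to at
    least \<open>- 2 M d N^(d - 1)\<close>. The successor in \<open>N\<close> keeps the grid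
    nonempty.\<close>
  obtain N0 :: nat where N0: "2 * M * d / \<epsilon> < N0" using reals_Archimedean2 by blast
  define N where "N = Suc N0"
  have N: "2 * M * d < \<epsilon> * N" "0 < N"
    using N0 \<epsilon> by (auto simp: N_def field_simps)
  have pt_upd: "(\<lambda>i. pt k i + (if i = j then \<delta> else 0)) = pt (k(j := Suc (k j)))" for k j
    by (auto simp: pt_def algebra_simps)
  have d0: "0 < d"
  proof (rule ccontr)
    assume "\<not> 0 < d"
    then show False using neg \<epsilon> by auto
  qed
  have "(\<Sum>j<d. - (2 * M * real N ^ (d - 1)))
      \<le> (\<Sum>j<d. \<Sum>k\<in>picks d N. \<psi> j (pt (k(j := Suc (k j)))) - \<psi> j (pt k))"
    using M by (intro sum_mono sum_grid_increment[where P = "\<lambda>k. \<psi> _ (pt k)"]) auto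
  also have "\<dots> = (\<Sum>k\<in>picks d N. \<Sum>j<d. \<psi> j (pt (k(j := Suc (k j)))) - \<psi> j (pt k))"
    by (rule sum.swap)
  also have "\<dots> < (\<Sum>k\<in>picks d N. - \<epsilon>)"
  proof (rule sum_strict_mono)
    show "finite (picks d N)" by (auto intro!: finite_PiE)
    show "picks d N \<noteq> {}" using N by (auto simp: PiE_eq_empty_iff)
    fix k
    show "(\<Sum>j<d. \<psi> j (pt (k(j := Suc (k j)))) - \<psi> j (pt k)) < - \<epsilon>"
      using neg unfolding pt_upd[symmetric] by (auto simp: not_le)
  qed
  finally have "\<epsilon> * real N ^ d < 2 * M * d * real N ^ (d - 1)"
    by (simp add: card_PiE algebra_simps)
  also have "real N ^ d = real N * real N ^ (d - 1)"
    using d0 by (metis power_minus_mult mult.commute)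
  finally have "(\<epsilon> * N) * real N ^ (d - 1) < (2 * M * d) * real N ^ (d - 1)"
    by (simp add: algebra_simps)
  then show False using N by (simp add: mult_less_cancel_right)
qed

section \<open>The sensitivity bound\<close>

text \<open>Pointwise, \<open>g \<le> g^2 / (2 \<tau>) + \<tau> / 2\<close>, which stands in for
  Cauchy--Schwarz.\<close>

lemma (in prob_space) expectation_le_of_second_moment:
  fixes g :: "'a \<Rightarrow> real"
  assumes [measurable]: "g \<in> borel_measurable M"
    and le: "(\<integral>\<^sup>+x. ennreal ((g x)\<^sup>2) \<partial>M) \<le> ennreal (\<tau>\<^sup>2)" and \<tau>: "0 < \<tau>"
  shows "expectation g \<le> \<tau>"
proof (cases "integrable M g")
  case True
  have fin: "(\<integral>\<^sup>+x. ennreal ((g x)\<^sup>2) \<partial>M) < \<infinity>"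
    using le by (rule le_less_trans) simp
  have int: "integrable M (\<lambda>x. (g x)\<^sup>2)"
    using fin by (intro integrableI_nonneg) auto
  have sq: "expectation (\<lambda>x. (g x)\<^sup>2) \<le> \<tau>\<^sup>2"
    using le int by (simp add: nn_integral_eq_integral)
  have "expectation g \<le> expectation (\<lambda>x. (g x)\<^sup>2 / (2 * \<tau>) + \<tau> / 2)"
  proof (rule integral_mono)
    fix x
    have "0 \<le> (g x - \<tau>)\<^sup>2" by simp
    then show "g x \<le> (g x)\<^sup>2 / (2 * \<tau>) + \<tau> / 2"
      using \<tau> by (simp add: field_simps power2_eq_square)
  qed (use True int in auto)
  also have "\<dots> = expectation (\<lambda>x. (g x)\<^sup>2) / (2 * \<tau>) + \<tau> / 2"
    using int by (simp add: prob_space)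
  also have "\<dots> \<le> \<tau>\<^sup>2 / (2 * \<tau>) + \<tau> / 2"
    using sq \<tau> by (intro add_right_mono divide_right_mono) auto
  also have "\<dots> = \<tau>" using \<tau> by (simp add: power2_eq_square)
  finally show ?thesis .
next
  \<comment> \<open>The Bochner integral of a non-integrable function is 0.\<close>
  case False
  then show ?thesis using \<tau> by (simp add: not_integrable_integral_eq)
qed

section \<open>Mixtures of bumps against a global shift of the mean\<close>

definition bump :: "nat \<Rightarrow> real \<Rightarrow> nat \<Rightarrow> (nat \<Rightarrow> nat) \<Rightarrow> nat \<Rightarrow> nat \<Rightarrow> real" where
  "bump G t j b = (\<lambda>i l. if l = j then t * of_bool (sel G b i) else 0)"

lemma integrable_tilt_times:
  assumes [measurable]: "(h :: _ \<Rightarrow> real) \<in> borel_measurable (data_space d n)"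
    and int: "integrable (gauss_data d n mu) (\<lambda>X. (h X)\<^sup>2)"
  shows "integrable (gauss_data d n mu) (\<lambda>X. tilt d n mu u X * h X)"
proof (rule Bochner_Integration.integrable_bound)
  show "integrable (gauss_data d n mu) (\<lambda>X. tilt d n mu u X * tilt d n mu u X + (h X)\<^sup>2)"
    using int integrable_tilt_mult by (rule Bochner_Integration.integrable_add[rotated])
  show "(\<lambda>X. tilt d n mu u X * h X) \<in> borel_measurable (gauss_data d n mu)"
    unfolding measurable_cong_sets[OF sets_gauss_data refl] by measurable
  have "\<bar>a * b\<bar> \<le> a * a + b\<^sup>2" for a b :: real
  proof -
    have "0 \<le> (\<bar>a\<bar> - \<bar>b\<bar>)\<^sup>2" by simp
    also have "\<dots> = a\<^sup>2 + b\<^sup>2 - 2 * \<bar>a * b\<bar>" by (simp add: power2_diff abs_mult)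
    finally show ?thesis using abs_ge_zero[of "a * b"] by (simp add: power2_eq_square)
  qed
  then show "AE X in gauss_data d n mu. norm (tilt d n mu u X * h X)
      \<le> norm (tilt d n mu u X * tilt d n mu u X + (h X)\<^sup>2)"
    by (intro AE_I2) (metis real_norm_def abs_ge_self order_trans)
qed

text \<open>Expanding the square leaves inner products of likelihood ratios. Their exponents are
  \<open>t^2\<close> times the overlap of two transversals, \<open>t^2 / G\<close> times the size of
  one, and \<open>t^2 n / G^2\<close>. The mixture is left unnormalized, hence the factors
  \<open>G ^ m\<close>.\<close>

lemma tilt_mixture_L2:
  fixes t :: real and mu :: "nat \<Rightarrow> real"
  assumes j: "j < d" and n: "n \<le> m * G" and G: "0 < G" and nG: "real n \<le> (real G)\<^sup>2"
    and t: "0 \<le> t" "t \<le> 1 / 2"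
  defines "T \<equiv> \<lambda>b X. tilt d n mu (bump G t j b) X"
    and "L \<equiv> \<lambda>X. tilt d n mu (\<lambda>i l. if l = j then t / G else 0) X"
  shows "integrable (gauss_data d n mu) (\<lambda>X. ((\<Sum>b\<in>picks m G. T b X) - real G ^ m * L X)\<^sup>2)"
    and "(\<integral>X. ((\<Sum>b\<in>picks m G. T b X) - real G ^ m * L X)\<^sup>2 \<partial>gauss_data d n mu)
      \<le> (real G ^ m)\<^sup>2 * (4 * t ^ 4 * (n / (real G)\<^sup>2))"
proof -
  let ?M = "gauss_data d n mu"
  define N where "N = real G ^ m"
  define s where "s = t\<^sup>2"
  define a where "a = n / (real G)\<^sup>2"
  have exp2: "((\<Sum>b\<in>picks m G. T b X) - N * L X)\<^sup>2
      = (\<Sum>b\<in>picks m G. \<Sum>b'\<in>picks m G. T b X * T b' X)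
        - 2 * N * (\<Sum>b\<in>picks m G. T b X * L X) + N\<^sup>2 * (L X * L X)" for X
  proof -
    have "(\<Sum>b\<in>picks m G. \<Sum>b'\<in>picks m G. T b X * T b' X)
        = (\<Sum>b\<in>picks m G. T b X) * (\<Sum>b\<in>picks m G. T b X)"
      by (rule sum_product[symmetric])
    moreover have "(\<Sum>b\<in>picks m G. T b X * L X) = (\<Sum>b\<in>picks m G. T b X) * L X"
      by (rule sum_distrib_right[symmetric])
    ultimately show ?thesis
      by (simp only: power2_diff power_mult_distrib) (simp add: power2_eq_square)
  qed
  have TT: "integrable ?M (\<lambda>X. T b X * T b' X)" for b b'
    unfolding T_def by (rule integrable_tilt_mult)
  have TL: "integrable ?M (\<lambda>X. T b X * L X)" for b
    unfolding T_def L_def by (rule integrable_tilt_mult)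
  have LL: "integrable ?M (\<lambda>X. L X * L X)"
    unfolding L_def by (rule integrable_tilt_mult)
  show "integrable ?M (\<lambda>X. ((\<Sum>b\<in>picks m G. T b X) - real G ^ m * L X)\<^sup>2)"
    unfolding N_def[symmetric] exp2 using TT TL LL by auto
  have iTT: "(\<integral>X. T b X * T b' X \<partial>?M) = exp (s * (\<Sum>i<n. of_bool (sel G b i) * of_bool (sel G b' i)))"
    for b b'
  proof -
    have "(\<Sum>l<d. bump G t j b i l * bump G t j b' i l)
        = s * (of_bool (sel G b i) * of_bool (sel G b' i))" for i
    proof -
      have "(\<Sum>l<d. bump G t j b i l * bump G t j b' i l)
          = (\<Sum>l<d. if l = j then s * (of_bool (sel G b i) * of_bool (sel G b' i)) else 0)"
        by (rule sum.cong) (auto simp: bump_def s_def power2_eq_square)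
      then show ?thesis using j by simp
    qed
    then show ?thesis unfolding T_def integral_tilt_mult sum_distrib_left by simp
  qed
  have iTL: "(\<integral>X. T b X * L X \<partial>?M) = exp (s / G * (\<Sum>i<n. of_bool (sel G b i)))" for b
  proof -
    have "(\<Sum>l<d. bump G t j b i l * (if l = j then t / G else 0)) = s / G * of_bool (sel G b i)" for i
    proof -
      have "(\<Sum>l<d. bump G t j b i l * (if l = j then t / G else 0))
          = (\<Sum>l<d. if l = j then s / G * of_bool (sel G b i) else 0)"
        by (rule sum.cong) (auto simp: bump_def s_def power2_eq_square)
      then show ?thesis using j by simp
    qed
    then show ?thesis unfolding T_def L_def integral_tilt_mult sum_distrib_left by simp
  qed
  have iLL: "(\<integral>X. L X * L X \<partial>?M) = exp (s * a)"
  proof -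
    have "(\<Sum>l<d. (if l = j then t / G else 0) * (if l = j then t / G else 0)) = s / (real G)\<^sup>2"
    proof -
      have "(\<Sum>l<d. (if l = j then t / G else 0) * (if l = j then t / G else 0))
          = (\<Sum>l<d. if l = j then s / (real G)\<^sup>2 else 0)"
        by (rule sum.cong) (auto simp: s_def power2_eq_square)
      then show ?thesis using j by simp
    qed
    then show ?thesis unfolding L_def integral_tilt_mult by (simp add: a_def mult.commute)
  qed
  have s: "0 \<le> s" "s \<le> 1 / 4"
    using t power_mono[of t "1 / 2" 2] by (auto simp: s_def power2_eq_square)
  have a: "0 \<le> a" "a \<le> 1"
    using nG G by (auto simp: a_def)
  have N0: "0 \<le> N" by (simp add: N_def)
  have "(\<integral>X. ((\<Sum>b\<in>picks m G. T b X) - N * L X)\<^sup>2 \<partial>?M)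
      = (\<Sum>b\<in>picks m G. \<Sum>b'\<in>picks m G. (\<integral>X. T b X * T b' X \<partial>?M))
        - 2 * N * (\<Sum>b\<in>picks m G. (\<integral>X. T b X * L X \<partial>?M)) + N\<^sup>2 * (\<integral>X. L X * L X \<partial>?M)"
    unfolding exp2 using TT TL LL by simp
  \<comment> \<open>The pair sum is bounded from above and the subtracted cross sum from
    below.\<close>
  also have "\<dots> \<le> N\<^sup>2 * exp ((exp s - 1) * a) - 2 * N * (N * (1 + s * a)) + N\<^sup>2 * exp (s * a)"
  proof (intro add_mono diff_mono order_refl mult_left_mono)
    show "(\<Sum>b\<in>picks m G. \<Sum>b'\<in>picks m G. (\<integral>X. T b X * T b' X \<partial>?M)) \<le> N\<^sup>2 * exp ((exp s - 1) * a)"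
      unfolding iTT N_def a_def using sum_picks_overlap_le[OF n G s(1)] by simp
    have "N * (1 + s / G * n / G) \<le> (\<Sum>b\<in>picks m G. (\<integral>X. T b X * L X \<partial>?M))"
      unfolding iTL N_def using s by (intro sum_picks_exp_ge[OF n G]) auto
    then show "N * (1 + s * a) \<le> (\<Sum>b\<in>picks m G. (\<integral>X. T b X * L X \<partial>?M))"
      by (simp add: a_def power2_eq_square)
  qed (use N0 iLL in auto)
  also have "\<dots> = N\<^sup>2 * (exp ((exp s - 1) * a) - 2 * (1 + s * a) + exp (s * a))"
    by (simp add: algebra_simps power2_eq_square)
  also have "\<dots> \<le> N\<^sup>2 * (4 * s\<^sup>2 * a)"
    by (intro mult_left_mono exp_second_order a s) auto
  finally show "(\<integral>X. ((\<Sum>b\<in>picks m G. T b X) - real G ^ m * L X)\<^sup>2 \<partial>?M)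
      \<le> (real G ^ m)\<^sup>2 * (4 * t ^ 4 * (n / (real G)\<^sup>2))"
    by (simp add: N_def s_def a_def power_mult[symmetric])
qed

lemma neg_mult_le_weighted_squares:
  fixes c x y :: real
  assumes "0 < c"
  shows "- (y * x) \<le> c / 2 * x\<^sup>2 + 1 / (2 * c) * y\<^sup>2"
proof -
  have "0 \<le> (c * x + y)\<^sup>2 / (2 * c)" using assms by simp
  also have "\<dots> = c / 2 * x\<^sup>2 + 1 / (2 * c) * y\<^sup>2 + y * x"
    using assms by (simp add: field_simps power2_eq_square)
  finally show ?thesis by simp
qed

text \<open>By Cauchy--Schwarz in weighted form, replacing the mixture of bumps by the global shift \<open>t / G\<close> of
  the mean costs only the last bracket.\<close>

lemma mean_bump_increment_ge:
  fixes t lam :: real and mu :: "nat \<Rightarrow> real"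
  assumes j: "j < d" and n: "n \<le> m * G" and G: "0 < G" and nG: "real n \<le> (real G)\<^sup>2"
    and t: "0 \<le> t" "t \<le> 1 / 2" and lam: "0 < lam"
    and h[measurable]: "(h :: _ \<Rightarrow> real) \<in> borel_measurable (data_space d n)"
    and int: "integrable (gauss_data d n mu) (\<lambda>X. (h X)\<^sup>2)"
  defines "L \<equiv> \<lambda>X. tilt d n mu (\<lambda>i l. if l = j then t / G else 0) X"
  shows "(\<integral>X. L X * h X \<partial>gauss_data d n mu) - (\<integral>X. h X \<partial>gauss_data d n mu)
      - (lam / 2 * (\<integral>X. (h X)\<^sup>2 \<partial>gauss_data d n mu) + 2 * t ^ 4 * (n / (real G)\<^sup>2) / lam)
    \<le> (\<Sum>b\<in>picks m G. \<integral>X. h (shift d n (bump G t j b) X) - h X \<partial>gauss_data d n mu) / real G ^ m"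
proof -
  let ?M = "gauss_data d n mu"
  interpret prob_space ?M by (rule prob_space_gauss_data)
  note [simp] = measurable_cong_sets[OF sets_gauss_data refl]
  define N where "N = real G ^ m"
  have N: "0 < N" using G by (simp add: N_def)
  define T where "T b X = tilt d n mu (bump G t j b) X" for b X
  define D where "D X = (\<Sum>b\<in>picks m G. T b X) - N * L X" for X
  note L2 = tilt_mixture_L2[OF j n G nG t, of mu]
  have D2: "integrable ?M (\<lambda>X. (D X)\<^sup>2)" "(\<integral>X. (D X)\<^sup>2 \<partial>?M) \<le> N\<^sup>2 * (4 * t ^ 4 * (n / (real G)\<^sup>2))"
    unfolding D_def T_def L_def N_def by (rule L2)+
  have iT: "integrable ?M (\<lambda>X. T b X * h X)" for b
    unfolding T_def by (rule integrable_tilt_times[OF h int])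
  have iL: "integrable ?M (\<lambda>X. L X * h X)"
    unfolding L_def by (rule integrable_tilt_times[OF h int])
  have ih: "integrable ?M h"
    by (rule square_integrable_imp_integrable[OF _ int]) simp
  have ish: "integrable ?M (\<lambda>X. h (shift d n (bump G t j b) X))" for b
    using integral_shift(2)[OF h] iT by (simp add: T_def)
  have cardF: "real (card (picks m G)) = N"
    by (simp add: card_PiE N_def)
  have Dh: "D X * h X = (\<Sum>b\<in>picks m G. T b X * h X) - N * (L X * h X)" for X
    by (simp add: D_def left_diff_distrib sum_distrib_right)
  have iD: "integrable ?M (\<lambda>X. D X * h X)"
    unfolding Dh using iT iL by auto
  have "(\<Sum>b\<in>picks m G. \<integral>X. h (shift d n (bump G t j b) X) - h X \<partial>?M)
      = (\<Sum>b\<in>picks m G. (\<integral>X. T b X * h X \<partial>?M) - (\<integral>X. h X \<partial>?M))"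
    using ish ih integral_shift(1)[OF h] by (simp add: T_def)
  also have "\<dots> = (\<Sum>b\<in>picks m G. (\<integral>X. T b X * h X \<partial>?M)) - N * (\<integral>X. h X \<partial>?M)"
    by (simp add: sum_subtractf cardF)
  also have "(\<Sum>b\<in>picks m G. (\<integral>X. T b X * h X \<partial>?M)) = N * (\<integral>X. L X * h X \<partial>?M) + (\<integral>X. D X * h X \<partial>?M)"
    unfolding Dh using iT iL by simp
  finally have eq: "(\<Sum>b\<in>picks m G. \<integral>X. h (shift d n (bump G t j b) X) - h X \<partial>?M)
      = N * (\<integral>X. L X * h X \<partial>?M) + (\<integral>X. D X * h X \<partial>?M) - N * (\<integral>X. h X \<partial>?M)" by simp
  \<comment> \<open>\<open>D\<close> is the error of the unnormalized mixture, of order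
    \<open>N\<close>. The weight \<open>N * lam\<close> therefore gives both resulting terms the
    common factor \<open>N\<close>.\<close>
  have "- (\<integral>X. D X * h X \<partial>?M) = (\<integral>X. - (D X * h X) \<partial>?M)" by simp
  also have "\<dots> \<le> (\<integral>X. N * lam / 2 * (h X)\<^sup>2 + 1 / (2 * N * lam) * (D X)\<^sup>2 \<partial>?M)"
  proof (rule integral_mono)
    fix X
    show "- (D X * h X) \<le> N * lam / 2 * (h X)\<^sup>2 + 1 / (2 * N * lam) * (D X)\<^sup>2"
      using neg_mult_le_weighted_squares[of "N * lam" "D X" "h X"] N lam by (simp add: mult.assoc)
  qed (use iD D2 int in auto)
  also have "\<dots> = N * lam / 2 * (\<integral>X. (h X)\<^sup>2 \<partial>?M) + 1 / (2 * N * lam) * (\<integral>X. (D X)\<^sup>2 \<partial>?M)"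
    using D2 int by simp
  also have "\<dots> \<le> N * lam / 2 * (\<integral>X. (h X)\<^sup>2 \<partial>?M)
      + 1 / (2 * N * lam) * (N\<^sup>2 * (4 * t ^ 4 * (n / (real G)\<^sup>2)))"
    using D2 N lam by (intro add_left_mono mult_left_mono) auto
  also have "\<dots> = N * (lam / 2 * (\<integral>X. (h X)\<^sup>2 \<partial>?M) + 2 * t ^ 4 * (n / (real G)\<^sup>2) / lam)"
  proof -
    have "1 / (2 * N * lam) * (N\<^sup>2 * (4 * w)) = N * (2 * w / lam)" for w
      using N lam by (simp add: field_simps power2_eq_square)
    from this[of "t ^ 4 * (n / (real G)\<^sup>2)"] show ?thesis
      by (simp only: mult.assoc distrib_left times_divide_eq_right times_divide_eq_left)
  qed
  finally have "N * ((\<integral>X. L X * h X \<partial>?M) - (\<integral>X. h X \<partial>?M)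
      - (lam / 2 * (\<integral>X. (h X)\<^sup>2 \<partial>?M) + 2 * t ^ 4 * (n / (real G)\<^sup>2) / lam))
    \<le> (\<Sum>b\<in>picks m G. \<integral>X. h (shift d n (bump G t j b) X) - h X \<partial>?M)"
    unfolding eq right_diff_distrib by linarith
  then show ?thesis
    using N unfolding N_def[symmetric] by (simp only: pos_le_divide_eq mult.commute)
qed

section \<open>Corruptions, coordinates and sensitivity\<close>

lemma hamming_shift_bump_le:
  assumes n: "n \<le> m * G" and X: "X \<in> space (data_space d n)"
  shows "hamming n X (shift d n (bump G t j b) X) \<le> m"
proof -
  have "X i = shift d n (bump G t j b) X i" if i: "i < n" and ns: "\<not> sel G b i" for i
  proof -
    \<comment> \<open>Rows are compared as functions on all of \<open>nat\<close>, so an unselected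
      row is unchanged only because it is extensional.\<close>
    have "X i \<in> extensional {..<d}"
      using X i by (auto simp: data_space_def vec_space_def space_PiM PiE_iff)
    then have "X i = restrict (X i) {..<d}" by (rule extensional_restrict[symmetric])
    also have "\<dots> = shift d n (bump G t j b) X i"
      using i ns by (auto simp: shift_def bump_def)
    finally show ?thesis .
  qed
  then have "{i\<in>{..<n}. X i \<noteq> shift d n (bump G t j b) X i} \<subseteq> {i\<in>{..<n}. sel G b i}"
    by auto
  then have "hamming n X (shift d n (bump G t j b) X) \<le> card {i\<in>{..<n}. sel G b i}"
    unfolding hamming_def by (intro card_mono) auto
  also have "\<dots> \<le> m" by (rule card_sel_le[OF n])
  finally show ?thesis .
qed

lemma abs_le_vnorm: "j < d \<Longrightarrow> \<bar>v j\<bar> \<le> vnorm d v"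
  unfolding vnorm_def
  by (rule real_le_rsqrt) (auto intro!: member_le_sum[of j "{..<d}" "\<lambda>j. (v j)\<^sup>2"])

lemma coordinate_le_sens:
  assumes "j < d" "X' \<in> space (data_space d n)" "hamming n X X' \<le> nat \<lfloor>eta * real n\<rfloor>"
  shows "ennreal ((f X' j - f X j)\<^sup>2) \<le> (sens d n f eta X)\<^sup>2"
proof -
  have "ennreal \<bar>f X j - f X' j\<bar> \<le> ennreal (vnorm d (\<lambda>j. f X j - f X' j))"
    using abs_le_vnorm[of j d "\<lambda>j. f X j - f X' j"] assms by (intro ennreal_leI) auto
  also have "\<dots> \<le> sens d n f eta X"
    unfolding sens_def using assms by (intro SUP_upper) auto
  finally have "(ennreal \<bar>f X j - f X' j\<bar>)\<^sup>2 \<le> (sens d n f eta X)\<^sup>2"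
    by (intro power_mono) auto
  then show ?thesis by (simp add: ennreal_power power2_commute)
qed

text \<open>A finite bound rules out the infinite branch of \<open>ES2\<close>, so
  \<open>enn2real\<close> loses nothing.\<close>

lemma second_moment_of_ES2_less:
  assumes "ES2 d n f eta mu < ennreal \<tau>"
  shows "(\<integral>\<^sup>+ X. (sens d n f eta X)\<^sup>2 \<partial>gauss_data d n mu) \<le> ennreal (\<tau>\<^sup>2)"
proof -
  define E where "E = (\<integral>\<^sup>+ X. (sens d n f eta X)\<^sup>2 \<partial>gauss_data d n mu)"
  have E: "E \<noteq> \<top>" "ennreal (sqrt (enn2real E)) < ennreal \<tau>"
    using assms by (auto simp: ES2_def E_def[symmetric] Let_def split: if_splits)
  then have "sqrt (enn2real E) < \<tau>" by (simp add: ennreal_less_iff)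
  then have "(sqrt (enn2real E))\<^sup>2 \<le> \<tau>\<^sup>2" by (intro power_mono) auto
  then have "ennreal (enn2real E) \<le> ennreal (\<tau>\<^sup>2)" by (intro ennreal_leI) simp
  then show ?thesis using E unfolding E_def by (simp add: ennreal_enn2real less_top[symmetric])
qed

theorem theorem3p3:
  fixes C_MSE :: real
  assumes "C_MSE > 0"
  shows "\<exists>\<kappa>>0. \<exists>c_low>0. \<exists>N0::nat.
     \<forall>d n f eta. d \<ge> 1 \<longrightarrow> n \<ge> N0 \<longrightarrow>
       f \<in> measurable (data_space d n) (vec_space d) \<longrightarrow>
       unif_mse_accurate C_MSE d n f \<longrightarrow>
       0 < eta \<longrightarrow> eta < 1 \<longrightarrow>
       1 \<le> \<lfloor>eta * real n\<rfloor> \<longrightarrow> real_of_int \<lfloor>eta * real n\<rfloor> \<le> \<kappa> * sqrt (real n) \<longrightarrow>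
       (SUP mu. ES2 d n f eta mu) \<ge> ennreal (c_low * eta)"
proof -
  \<comment> \<open>The bound \<open>1 / 2\<close> is required by \<open>tilt_mixture_L2\<close>;
    the other one gives \<open>Ct\<close>, which keeps the \<open>L^2\<close> error in
    \<open>e2\<close> below \<open>\<delta> / 8\<close>.\<close>
  define t where "t = min (1 / 2) (1 / (8 * sqrt C_MSE))"
  have t: "0 < t" "t \<le> 1 / 2" using assms by (auto simp: t_def)
  have Ct: "64 * C_MSE * t\<^sup>2 \<le> 1"
  proof -
    have "t * (8 * sqrt C_MSE) \<le> 1"
      using assms by (simp add: t_def min_def field_simps)
    then have "(t * (8 * sqrt C_MSE))\<^sup>2 \<le> 1\<^sup>2" using t assms by (intro power_mono) auto
    then show ?thesis using assms by (simp add: power_mult_distrib mult_ac)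
  qed
  \<comment> \<open>The witnesses are \<open>\<kappa> = 1\<close>, so that
    \<open>m \<le> sqrt n\<close>, then \<open>c_low = t / 32\<close> and \<open>N0 = 1\<close>. The
    factor 32 makes \<open>\<tau>\<close> smaller than the quarter of \<open>t / G\<close> that
    survives all error terms.\<close>
  show ?thesis
  proof (rule exI[of _ "1::real"], intro conjI, simp, rule exI[of _ "t / 32"], intro conjI,
      use t in simp, rule exI[of _ "1::nat"], intro allI impI, rule ccontr)
    fix d n :: nat and f :: "(nat \<Rightarrow> nat \<Rightarrow> real) \<Rightarrow> nat \<Rightarrow> real" and eta :: real
    assume d: "1 \<le> d" and n1: "1 \<le> n" and f: "f \<in> measurable (data_space d n) (vec_space d)"
      and acc: "unif_mse_accurate C_MSE d n f" and eta: "0 < eta" "eta < 1"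
      and fl: "1 \<le> \<lfloor>eta * real n\<rfloor>" "real_of_int \<lfloor>eta * real n\<rfloor> \<le> 1 * sqrt (real n)"
      and neg: "\<not> ennreal (t / 32 * eta) \<le> (SUP mu. ES2 d n f eta mu)"
    define \<tau> where "\<tau> = t / 32 * eta"
    have \<tau>: "0 < \<tau>" using t eta by (simp add: \<tau>_def)
    have sens2: "(\<integral>\<^sup>+ X. (sens d n f eta X)\<^sup>2 \<partial>gauss_data d n mu) \<le> ennreal (\<tau>\<^sup>2)" for mu
    proof (rule second_moment_of_ES2_less)
      have "ES2 d n f eta mu \<le> (SUP mu. ES2 d n f eta mu)" by (rule SUP_upper) simp
      also have "\<dots> < ennreal \<tau>" using neg by (simp add: \<tau>_def not_le)
      finally show "ES2 d n f eta mu < ennreal \<tau>" .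
    qed
    define m where "m = nat \<lfloor>eta * real n\<rfloor>"
    have m1: "1 \<le> m" using fl(1) unfolding m_def by linarith
    have m_eq: "real m = real_of_int \<lfloor>eta * real n\<rfloor>" using fl(1) unfolding m_def by linarith
    have m_sqrt: "real m \<le> sqrt n" using fl m_eq by simp
    have m_le: "real m \<le> eta * n" and m_gt: "eta * n < real m + 1"
      using m_eq by linarith+
    have mn: "m \<le> n"
    proof -
      have "eta * n \<le> 1 * real n" using eta by (intro mult_right_mono) auto
      then show ?thesis using m_le by simp
    qed
    \<comment> \<open>With this block length, \<open>m\<close> blocks always cover the
      \<open>n\<close> indices, while \<open>m * G \<le> n + m \<le> 2 * n\<close>.\<close>
    define G where "G = n div m + 1"
    have G: "0 < G" by (simp add: G_def)
    have nmG: "n \<le> m * G" using dividend_less_times_div[of m n] m1 by (simp add: G_def)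
    have mG: "m * G \<le> 2 * n"
      using add_mono[OF mn times_div_less_eq_dividend[of m n]] by (simp add: G_def mult_2)
    have nG: "real n \<le> (real G)\<^sup>2"
    proof -
      have "sqrt n * sqrt n \<le> real (m * G)" using nmG by (simp del: of_nat_mult)
      also have "\<dots> = real m * real G" by simp
      also have "\<dots> \<le> sqrt n * G" using m_sqrt by (intro mult_right_mono) auto
      finally have "sqrt n \<le> G"
        by (rule mult_left_le_imp_le) (use n1 in simp)
      then have "(sqrt n)\<^sup>2 \<le> (real G)\<^sup>2" by (intro power_mono) auto
      then show ?thesis by simp
    qed
    \<comment> \<open>From \<open>eta n < m + 1 \<le> 2 m\<close> and \<open>m G \<le> 2 n\<close>
      follows \<open>eta G \<le> 4\<close>.\<close>
    have \<tau>G: "2 * \<tau> \<le> t / (4 * G)"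
    proof -
      have "eta * n * G \<le> 2 * real m * G" using m_gt m1 by (intro mult_right_mono) auto
      also have "\<dots> = 2 * real (m * G)" by simp
      also have "\<dots> \<le> 4 * real n" using mG by linarith
      finally have "real n * (eta * G) \<le> real n * 4" by (simp only: mult_ac)
      then have "eta * G \<le> 4" by (rule mult_left_le_imp_le) (use n1 in simp)
      then have "t * (eta * G) \<le> t * 4" using t by (intro mult_left_mono) auto
      then have "2 * \<tau> * (4 * G) \<le> t" by (simp add: \<tau>_def mult_ac)
      then show ?thesis using G by (simp add: pos_le_divide_eq)
    qed

    \<comment> \<open>Second moments and bias of the coordinates\<close>
    define Q where "Q = C_MSE * d / n"
    have Q: "0 < Q" using assms d n1 by (simp add: Q_def)
    define h where "h mu j X = f X j - mu j" for mu :: "nat \<Rightarrow> real" and j X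
    have fj: "j < d \<Longrightarrow> (\<lambda>X. f X j) \<in> borel_measurable (data_space d n)" for j
      using f unfolding vec_space_def
      by (rule measurable_compose) (auto intro!: measurable_component_singleton)
    have hm: "j < d \<Longrightarrow> h mu j \<in> borel_measurable (data_space d n)" for mu j
      using fj[of j] unfolding h_def[abs_def] by measurable
    have hm': "j < d \<Longrightarrow> h mu j \<in> borel_measurable (gauss_data d n mu')" for mu mu' j
      using hm by (simp add: measurable_cong_sets[OF sets_gauss_data refl])
    have total: "(\<integral>\<^sup>+X. ennreal (\<Sum>j<d. (h mu j X)\<^sup>2) \<partial>gauss_data d n mu) \<le> ennreal Q" for mu
    proof -
      have "(\<Sum>j<d. (h mu j X)\<^sup>2) = (vnorm d (\<lambda>j. f X j - mu j))\<^sup>2" for X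
        by (simp add: vnorm_def h_def sum_nonneg)
      then show ?thesis using acc unfolding unif_mse_accurate_def Q_def by simp
    qed
    have each: "(\<integral>\<^sup>+X. ennreal ((h mu j X)\<^sup>2) \<partial>gauss_data d n mu) \<le> ennreal Q" if "j < d" for mu j
    proof -
      have "(\<integral>\<^sup>+X. ennreal ((h mu j X)\<^sup>2) \<partial>gauss_data d n mu)
          \<le> (\<integral>\<^sup>+X. ennreal (\<Sum>j<d. (h mu j X)\<^sup>2) \<partial>gauss_data d n mu)"
        using that by (intro nn_integral_mono ennreal_leI member_le_sum) auto
      then show ?thesis using total by (rule order_trans)
    qed
    have hint: "integrable (gauss_data d n mu) (\<lambda>X. (h mu j X)\<^sup>2)" if "j < d" for mu j
    proof (rule integrableI_nonneg)
      show "(\<lambda>X. (h mu j X)\<^sup>2) \<in> borel_measurable (gauss_data d n mu)"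
        using hm'[OF that] by measurable
      show "(\<integral>\<^sup>+X. ennreal ((h mu j X)\<^sup>2) \<partial>gauss_data d n mu) < \<infinity>"
        using each[OF that] by (rule le_less_trans) simp
    qed simp
    have hsum: "(\<Sum>j<d. \<integral>X. (h mu j X)\<^sup>2 \<partial>gauss_data d n mu) \<le> Q" for mu
    proof -
      have "integrable (gauss_data d n mu) (\<lambda>X. \<Sum>j<d. (h mu j X)\<^sup>2)" using hint by auto
      then have "(\<integral>X. (\<Sum>j<d. (h mu j X)\<^sup>2) \<partial>gauss_data d n mu) \<le> Q"
        using total[of mu] Q by (simp add: nn_integral_eq_integral sum_nonneg)
      then show ?thesis using hint by simp
    qed
    define \<psi> where "\<psi> j mu = (\<integral>X. h mu j X \<partial>gauss_data d n mu)" for j mu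
    \<comment> \<open>A crude bound on the bias is enough: its size disappears when the cube in
      \<open>bounded_field_divergence\<close> grows.\<close>
    have \<psi>_bound: "\<bar>\<psi> j mu\<bar> \<le> 1 + Q" if "j < d" for j mu
    proof -
      interpret prob_space "gauss_data d n mu" by (rule prob_space_gauss_data)
      have "Q \<le> (1 + Q)\<^sup>2" using Q by (simp add: power2_eq_square algebra_simps)
      then have le: "(\<integral>\<^sup>+X. ennreal ((h mu j X)\<^sup>2) \<partial>gauss_data d n mu) \<le> ennreal ((1 + Q)\<^sup>2)"
        using each[OF that] by (meson ennreal_leI order_trans)
      have "\<psi> j mu \<le> 1 + Q"
        unfolding \<psi>_def using hm'[OF that] le Q by (intro expectation_le_of_second_moment) auto
      moreover have "(\<integral>X. - h mu j X \<partial>gauss_data d n mu) \<le> 1 + Q"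
        using hm'[OF that] le Q by (intro expectation_le_of_second_moment) auto
      ultimately show ?thesis by (simp add: \<psi>_def abs_le_iff)
    qed
    define \<delta> where "\<delta> = t / G"
    have \<delta>: "0 < \<delta>" using t G by (simp add: \<delta>_def)
    \<comment> \<open>At this \<open>mu\<close> the bias increments cancel at most half of the total
      increase \<open>d * \<delta>\<close> of the means.\<close>
    obtain mu where mu: "- (d * \<delta> / 2)
        \<le> (\<Sum>j<d. \<psi> j (\<lambda>i. mu i + (if i = j then \<delta> else 0)) - \<psi> j mu)"
      using bounded_field_divergence[where \<psi> = \<psi> and d = d and M = "1 + Q" and \<epsilon> = "d * \<delta> / 2" and \<delta> = \<delta>]
        \<psi>_bound \<delta> d by auto
    let ?M = "gauss_data d n mu"
    define L where "L j X = tilt d n mu (\<lambda>i l. if l = j then t / G else 0) X" for j X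
    \<comment> \<open>Under the shifted mean the error is measured from a target larger by
      \<open>\<delta>\<close>; this produces the gain of \<open>\<delta>\<close> per
      coordinate.\<close>
    have \<psi>_shift: "\<psi> j (\<lambda>i. mu i + (if i = j then \<delta> else 0)) = (\<integral>X. L j X * h mu j X \<partial>?M) - \<delta>"
      if j: "j < d" for j
    proof -
      have hh: "h (\<lambda>i. mu i + (if i = j then \<delta> else 0)) j = (\<lambda>X. h mu j X - \<delta>)"
        by (simp add: h_def fun_eq_iff)
      have "\<psi> j (\<lambda>i. mu i + (if i = j then \<delta> else 0)) = (\<integral>X. L j X * (h mu j X - \<delta>) \<partial>?M)"
        unfolding \<psi>_def hh L_def \<delta>_def[symmetric]
        using hm[OF j] by (intro integral_gauss_data_add) auto
      also have "\<dots> = (\<integral>X. L j X * h mu j X - L j X * \<delta> \<partial>?M)"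
        by (simp add: right_diff_distrib)
      also have "\<dots> = (\<integral>X. L j X * h mu j X \<partial>?M) - \<delta>"
        using integrable_tilt_times[OF hm[OF j] hint[OF j]] integrable_tilt integral_tilt
        by (simp add: L_def)
      finally show ?thesis .
    qed
    \<comment> \<open>Chosen so that \<open>lam / 2 * Q = d * (\<delta> / 8)\<close>.\<close>
    define lam where "lam = n * t / (4 * C_MSE * G)"
    have lam: "0 < lam" using n1 t assms G by (simp add: lam_def)
    have inc_le: "(\<integral>X. h mu j (shift d n (bump G t j b) X) - h mu j X \<partial>?M) \<le> \<tau>"
      if j: "j < d" for j b
    proof -
      interpret prob_space ?M by (rule prob_space_gauss_data)
      show ?thesis
      proof (rule expectation_le_of_second_moment)
        show "(\<lambda>X. h mu j (shift d n (bump G t j b) X) - h mu j X) \<in> borel_measurable ?M"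
          unfolding measurable_cong_sets[OF sets_gauss_data refl]
          using hm[OF j] by measurable
        have "(\<integral>\<^sup>+X. ennreal ((h mu j (shift d n (bump G t j b) X) - h mu j X)\<^sup>2) \<partial>?M)
            \<le> (\<integral>\<^sup>+X. (sens d n f eta X)\<^sup>2 \<partial>?M)"
        proof (rule nn_integral_mono)
          fix X assume "X \<in> space ?M"
          then have X: "X \<in> space (data_space d n)"
            using sets_eq_imp_space_eq[OF sets_gauss_data] by blast
          show "ennreal ((h mu j (shift d n (bump G t j b) X) - h mu j X)\<^sup>2) \<le> (sens d n f eta X)\<^sup>2"
            using coordinate_le_sens[OF j measurable_space[OF measurable_shift X]
                hamming_shift_bump_le[OF nmG X, unfolded m_def]]
            by (simp add: h_def)
        qed
        then show "(\<integral>\<^sup>+X. ennreal ((h mu j (shift d n (bump G t j b) X) - h mu j X)\<^sup>2) \<partial>?M)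
            \<le> ennreal (\<tau>\<^sup>2)"
          using sens2 by (rule order_trans)
      qed (rule \<tau>)
    qed
    have bound: "(\<integral>X. L j X * h mu j X \<partial>?M) - \<psi> j mu
      - (lam / 2 * (\<integral>X. (h mu j X)\<^sup>2 \<partial>?M) + 2 * t ^ 4 * (n / (real G)\<^sup>2) / lam) \<le> \<tau>" if j: "j < d" for j
    proof -
      have "(\<integral>X. L j X * h mu j X \<partial>?M) - \<psi> j mu
          - (lam / 2 * (\<integral>X. (h mu j X)\<^sup>2 \<partial>?M) + 2 * t ^ 4 * (n / (real G)\<^sup>2) / lam)
        \<le> (\<Sum>b\<in>picks m G. \<integral>X. h mu j (shift d n (bump G t j b) X) - h mu j X \<partial>?M) / real G ^ m"
        unfolding L_def \<psi>_def using t
        by (intro mean_bump_increment_ge j nmG G nG lam hm[OF j] hint[OF j]) auto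
      also have "\<dots> \<le> (\<Sum>b\<in>picks m G. \<tau>) / real G ^ m"
        by (intro divide_right_mono sum_mono inc_le j) auto
      also have "\<dots> = \<tau>" using G by (simp add: card_PiE)
      finally show ?thesis .
    qed

    \<comment> \<open>Summation over the coordinates\<close>
    have "(\<Sum>j<d. (\<psi> j (\<lambda>i. mu i + (if i = j then \<delta> else 0)) - \<psi> j mu) + \<delta>
        - lam / 2 * (\<integral>X. (h mu j X)\<^sup>2 \<partial>?M) - 2 * t ^ 4 * (n / (real G)\<^sup>2) / lam) \<le> (\<Sum>j<d. \<tau>)"
      using bound by (intro sum_mono) (auto simp: \<psi>_shift algebra_simps)
    then have le1: "(\<Sum>j<d. \<psi> j (\<lambda>i. mu i + (if i = j then \<delta> else 0)) - \<psi> j mu) + d * \<delta>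
        - lam / 2 * (\<Sum>j<d. \<integral>X. (h mu j X)\<^sup>2 \<partial>?M) - d * (2 * t ^ 4 * (n / (real G)\<^sup>2) / lam) \<le> d * \<tau>"
      by (simp add: sum.distrib sum_subtractf sum_distrib_left)
    \<comment> \<open>Accuracy bounds only the sum of the coordinate errors by \<open>Q\<close>.
      Summing over \<open>j\<close> thus costs \<open>Q / d = C_MSE / n\<close> per coordinate on
      average, and the constants do not depend on \<open>d\<close>.\<close>
    have e1: "lam / 2 * (\<Sum>j<d. \<integral>X. (h mu j X)\<^sup>2 \<partial>?M) \<le> d * (\<delta> / 8)"
    proof -
      have "lam / 2 * (\<Sum>j<d. \<integral>X. (h mu j X)\<^sup>2 \<partial>?M) \<le> lam / 2 * Q"
        using hsum lam by (intro mult_left_mono) auto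
      also have "\<dots> = d * (\<delta> / 8)"
        using assms n1 G by (simp add: lam_def Q_def \<delta>_def field_simps)
      finally show ?thesis .
    qed
    have e2: "d * (2 * t ^ 4 * (n / (real G)\<^sup>2) / lam) \<le> d * (\<delta> / 8)"
    proof (rule mult_left_mono)
      have "2 * t ^ 4 * (n / (real G)\<^sup>2) / lam = (64 * C_MSE * t\<^sup>2) * (\<delta> / 8)"
        using assms n1 G t by (simp add: lam_def \<delta>_def field_simps power2_eq_square power4_eq_xxxx)
      also have "\<dots> \<le> 1 * (\<delta> / 8)" using Ct \<delta> by (intro mult_right_mono) auto
      finally show "2 * t ^ 4 * (n / (real G)\<^sup>2) / lam \<le> \<delta> / 8" by simp
    qed simp
    \<comment> \<open>The balance is \<open>1 - 1/2 - 1/8 - 1/8 = 1/4\<close> in units of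
      \<open>d * \<delta>\<close>. Since \<open>2 * \<tau> \<le> \<delta> / 4\<close> and
      \<open>\<tau> > 0\<close>, this is absurd.\<close>
    have "d * (\<delta> / 4) \<le> d * \<tau>" using le1 e1 e2 mu by simp
    then have "\<delta> / 4 \<le> \<tau>" using d by simp
    then show False using \<tau>G \<tau> by (simp add: \<delta>_def)
  qed
qed

end
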